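(* Let $Y$ be a Banach space, $\Phi:Y\to Y$ Lipschitz continuous, $\mathcal{A}\subset Y$ compact with $\Phi(\mathcal{A})=\mathcal{A}$, $R:Y\to\mathbb{R}^k$ an observation map that is one-to-one on $\mathcal{A}$, $A_k=R(\mathcal{A})$, and $\varphi=R\circ\Phi\circ E:\mathbb{R}^k\to\mathbb{R}^k$ the core dynamical system. Let $u^*\in\mathcal{A}$ be a steady state of $\Phi$ with $\mathcal{W}^u_\Phi(u^* )\subset\mathcal{A}$, $p=R(u^* )$, $W^u(p)=R(\mathcal{W}^u_\Phi(u^* ))$, and $W^u_{loc}(p)=R\big(\overline{\mathcal{W}^u_{\Phi,loc}(u^* )}\big)$. Let $Q\subset\mathbb{R}^k$ be a compact generalized rectangle with $\overline{W^u(p)}\subset Q$, let $(\mathcal{P}_n)_{n\in\mathbb{N}}$ be a nested sequence of successively finer partitions of $Q$, and let $C=\mathcal{P}_s(p)\in\mathcal{P}_s$ be an element containing $p$ in its interior. Assume that $\overline{\mathcal{W}^u_{\Phi,loc}(u^* )}$ is a compact attracting set of $\Phi$ with basin of attraction $\mathcal{U}\supset\overline{\mathcal{W}^u_{\Phi,loc}(u^* )}$, and that $W^u_{loc}(p)\subset C\subset A_k$ and $E(C)\subset\mathcal{U}$. Put $W_0=W^u_{loc}(p)$ and $W_{j+1}=\varphi(W_j)$ for $j\ge0$, and let $C_j^{(\ell)}$ and $G_\ell$ ($j,\ell\ge0$) be the sets generated by the continuation method described in the context. (a) The sets $C_j^{(\ell)}$ are coverings of $W_j$ (that is, $W_j\subset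 C_j^{(\ell)}$) for all $j,\ell=0,1,\dots$. Moreover, for each fixed $j$, $$\bigcap_{\ell=0}^\infty C_j^{(\ell)}=W_j .$$ (b) Suppose that $\overline{W^u(p)}$ is linearly attractive, i.e. there are $\lambda\in(0,1)$ and a neighborhood $U\supset Q\supset\overline{W^u(p)}$ such that $$\mathrm{dist}\big(\varphi(y),\overline{W^u(p)}\big)\le\lambda\,\mathrm{dist}\big(y,\overline{W^u(p)}\big)\qquad\text{for all }y\in U .$$ Then the box coverings $G_\ell$ converge to the closure of the embedded unstable manifold, that is, $$\bigcap_{\ell=0}^\infty G_\ell=\overline{W^u(p)} .$$
   Context: Observation map: $R$ is either a bounded linear map $R:Y\to\mathbb{R}^k$, or a delay observation map $R(u)=(f(u),f(\Phi(u)),\dots,f(\Phi^{k-1}(u)))^T$ with $f:Y\to\mathbb{R}$ Lipschitz (or the analogous map built from several Lipschitz observables), chosen so that $R$ is one-to-one on $\mathcal{A}$; it restricts to a homeomorphism from $\mathcal{A}$ onto $A_k$. Core dynamical system: $\widetilde E:A_k\to Y$ is the continuous map with $(\widetilde E\circ R)(u)=u$ for $u\in\mathcal{A}$ and $(R\circ\widetilde E)(x)=x$ for $x\in A_k$; $E:\mathbb{R}^k\to Y$ is a (fixed) continuous extension of $\widetilde E$ (Dugundji); $\varphi=R\circ\Phi\circ E$ is continuous on $\mathbb{R}^k$ and satisfies $\varphi(R(u))=R(\Phi(u))$ for $u\in\mathcal{A}$. Unstable manifolds: a steady state satisfies $\Phi(u^* )=u^*$. $\mathcal{W}^u_\Phi(u^*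 )$ is the set of points $u$ admitting a backward orbit $(u_{-j})_{j\ge0}$, $u_0=u$, $\Phi(u_{-j-1})=u_{-j}$, with $u_{-j}\to u^*$. A local unstable manifold $\mathcal{W}^u_{\Phi,loc}(u^* )$ is the set of points admitting such a backward orbit that remains in a fixed neighborhood of $u^*$ for all $j\ge0$. $W^u(p)$ is called the embedded unstable manifold. Attracting set: a compact set $K\subset Y$ is attracting if it has an open neighborhood $U_0\supset K$ such that for every open $V\supset K$ there is $N$ with $\Phi^j(U_0)\subset V$ for all $j\ge N$; its basin of attraction is $\bigcup_{j\ge0}\Phi^{-j}(U_0)$. Partitions: a generalized rectangle is a set $\{y\in\mathbb{R}^k:|y_i-c_i|\le r_i,\ i=1,\dots,k\}$ with $c\in\mathbb{R}^k$, $r_i>0$. A partition $\mathcal{P}$ of $Q$ is a finite family of compact subsets of $Q$ with $\bigcup_{B\in\mathcal{P}}B=Q$ and $\mathrm{int}\,B\cap\mathrm{int}\,B'=\emptyset$ for $B\ne B'$; $\mathcal{P}(x)$ denotes the element of $\mathcal{P}$ containing $x\in Q$. Nested successively finer means: there is $\theta\in(0,1)$ such that for all $n$ each $B\in\mathcal{P}_n$ is a union $B=\bigcup_i B_i$ of finitely many $B_1,\dots,B_m\in\mathcal{P}_{n+1}$ with $\mathrm{diam}(B_i)\le\theta\,\mathrm{diam}(B)$, and $\mathcal{P}_{n+1}$ consists of the sets $B_i$ so obtained. Continuation method. (1) Subdivision of $C$: set $\mathcal{B}_0=\{C\}$, and for $\ell\ge1$ let $\hat{\mathcal{B}}_\ell\subset\mathcal{P}_{s+\ell}$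 be the collection of the elements of $\mathcal{P}_{s+\ell}$ into which the elements of $\mathcal{B}_{\ell-1}\subset\mathcal{P}_{s+\ell-1}$ are subdivided (so that $\bigcup_{B\in\hat{\mathcal{B}}_\ell}B=\bigcup_{B\in\mathcal{B}_{\ell-1}}B$), and put $$\mathcal{B}_\ell=\{B\in\hat{\mathcal{B}}_\ell:\ \exists\,\hat B\in\hat{\mathcal{B}}_\ell\text{ with }\varphi^{-1}(B)\cap\hat B\ne\emptyset\}.$$ (2) Set $\mathcal{C}_0^{(\ell)}=\mathcal{B}_\ell$. (3) For $j\ge0$ set $$\mathcal{C}_{j+1}^{(\ell)}=\{B\in\mathcal{P}_{s+\ell}:\ \exists\,B'\in\mathcal{C}_j^{(\ell)}\text{ with }B\cap\varphi(B')\ne\emptyset\}.$$ Put $C_j^{(\ell)}=\bigcup_{B\in\mathcal{C}_j^{(\ell)}}B$. Since $\mathcal{P}_{s+\ell}$ is finite, after finitely many steps, say $J_\ell$, no new boxes are added, and $G_\ell=\bigcup_{j=0}^{J_\ell}C_j^{(\ell)}$ $\big(=\bigcup_{j\ge0}C_j^{(\ell)}\big)$. $\mathrm{dist}(y,S)=\inf_{z\in S}\|y-z\|$ on $\mathbb{R}^k$. *)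

theory Defs
  imports "HOL-Analysis.Analysis"
begin

section \<open>Observation maps and the core dynamical system\<close>

text \<open>The coordinates of \<open>real ^ 'k\<close> carry no canonical order, so the order of the delays is
  given by an enumeration \<open>\<iota>\<close> of the index type.\<close>

definition delay_map :: "('y \<Rightarrow> 'y) \<Rightarrow> ('y::real_normed_vector \<Rightarrow> real ^ 'k) \<Rightarrow> bool" where
  "delay_map \<Phi> R \<longleftrightarrow>
    (\<exists>(f :: 'y \<Rightarrow> real) \<iota>. (\<exists>L. L-lipschitz_on UNIV f) \<and>
      bij_betw \<iota> (UNIV :: 'k set) {..<CARD('k)} \<and>
      (\<forall>u i. R u $ i = f ((\<Phi> ^^ \<iota> i) u)))"

text \<open>Several observables \<open>f 0, \<dots>, f (q - 1)\<close>; the observable \<open>f a\<close> contributes the \<open>d a\<close>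
  coordinates \<open>f a u, f a (\<Phi> u), \<dots>, f a (\<Phi> ^^ (d a - 1) u)\<close>.\<close>

definition multi_delay_map :: "('y \<Rightarrow> 'y) \<Rightarrow> ('y::real_normed_vector \<Rightarrow> real ^ 'k) \<Rightarrow> bool" where
  "multi_delay_map \<Phi> R \<longleftrightarrow>
    (\<exists>(q::nat) (f :: nat \<Rightarrow> 'y \<Rightarrow> real) (d :: nat \<Rightarrow> nat) \<iota>.
      (\<forall>a<q. \<exists>L. L-lipschitz_on UNIV (f a)) \<and>
      bij_betw \<iota> (UNIV :: 'k set) (SIGMA a:{..<q}. {..<d a}) \<and>
      (\<forall>u i. R u $ i = f (fst (\<iota> i)) ((\<Phi> ^^ snd (\<iota> i)) u)))"

definition observation_map :: "('y \<Rightarrow> 'y) \<Rightarrow> ('y::real_normed_vector \<Rightarrow> real ^ 'k) \<Rightarrow> bool" where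
  "observation_map \<Phi> R \<longleftrightarrow> bounded_linear R \<or> delay_map \<Phi> R \<or> multi_delay_map \<Phi> R"

definition core_extension ::
    "('y::real_normed_vector \<Rightarrow> real ^ 'k) \<Rightarrow> 'y set \<Rightarrow> (real ^ 'k \<Rightarrow> 'y) \<Rightarrow> bool" where
  "core_extension R A E \<longleftrightarrow>
    continuous_on UNIV E \<and> (\<forall>u\<in>A. E (R u) = u) \<and> (\<forall>x\<in>R ` A. R (E x) = x)"

definition core_map ::
    "('y \<Rightarrow> real ^ 'k) \<Rightarrow> ('y \<Rightarrow> 'y) \<Rightarrow> (real ^ 'k \<Rightarrow> 'y) \<Rightarrow> real ^ 'k \<Rightarrow> real ^ 'k" where
  "core_map R \<Phi> E = R \<circ> \<Phi> \<circ> E"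


section \<open>Unstable manifolds and attracting sets\<close>

text \<open>\<open>v j\<close> is the point \<open>u\<^sub>-\<^sub>j\<close> of the backward orbit.\<close>

definition backward_orbit_to ::
    "('y::topological_space \<Rightarrow> 'y) \<Rightarrow> 'y \<Rightarrow> 'y \<Rightarrow> (nat \<Rightarrow> 'y) \<Rightarrow> bool" where
  "backward_orbit_to \<Phi> ustar u v \<longleftrightarrow>
    v 0 = u \<and> (\<forall>j. \<Phi> (v (Suc j)) = v j) \<and> v \<longlonglongrightarrow> ustar"

definition unstable_manifold :: "('y::topological_space \<Rightarrow> 'y) \<Rightarrow> 'y \<Rightarrow> 'y set" where
  "unstable_manifold \<Phi> ustar = {u. \<exists>v. backward_orbit_to \<Phi> ustar u v}"

definition local_unstable_manifold ::
    "('y::topological_space \<Rightarrow> 'y) \<Rightarrow> 'y \<Rightarrow> 'y set \<Rightarrow> 'y set" where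
  "local_unstable_manifold \<Phi> ustar N =
    {u. \<exists>v. backward_orbit_to \<Phi> ustar u v \<and> (\<forall>j. v j \<in> N)}"

text \<open>\<open>U0\<close> is the neighbourhood witnessing that \<open>K\<close> is attracting. All such witnesses have the
  same basin.\<close>

definition attracting_set ::
    "('y::topological_space \<Rightarrow> 'y) \<Rightarrow> 'y set \<Rightarrow> 'y set \<Rightarrow> bool" where
  "attracting_set \<Phi> K U0 \<longleftrightarrow>
    compact K \<and> open U0 \<and> K \<subseteq> U0 \<and>
    (\<forall>V. open V \<and> K \<subseteq> V \<longrightarrow> (\<exists>N. \<forall>j\<ge>N. (\<Phi> ^^ j) ` U0 \<subseteq> V))"

definition basin_of_attraction :: "('y \<Rightarrow> 'y) \<Rightarrow> 'y set \<Rightarrow> 'y set" where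
  "basin_of_attraction \<Phi> U0 = (\<Union>j. (\<Phi> ^^ j) -` U0)"

text \<open>Here \<open>U\<close> is a neighbourhood of \<open>S\<close> containing \<open>Q\<close>; it need not be a neighbourhood of \<open>Q\<close>.\<close>

definition linearly_attractive ::
    "('x::metric_space \<Rightarrow> 'x) \<Rightarrow> 'x set \<Rightarrow> 'x set \<Rightarrow> bool" where
  "linearly_attractive \<phi> Q S \<longleftrightarrow>
    (\<exists>lam\<in>{0<..<1::real}. \<exists>U. S \<subseteq> interior U \<and> Q \<subseteq> U \<and> S \<subseteq> Q \<and>
      (\<forall>y\<in>U. infdist (\<phi> y) S \<le> lam * infdist y S))"


section \<open>Partitions\<close>

definition generalized_rectangle :: "(real ^ 'k) set \<Rightarrow> bool" where
  "generalized_rectangle Q \<longleftrightarrow>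
    (\<exists>c r. (\<forall>i. 0 < r $ i) \<and> Q = {y. \<forall>i. \<bar>y $ i - c $ i\<bar> \<le> r $ i})"

definition box_partition :: "'x::metric_space set \<Rightarrow> 'x set set \<Rightarrow> bool" where
  "box_partition Q P \<longleftrightarrow>
    finite P \<and> (\<forall>B\<in>P. compact B \<and> B \<subseteq> Q) \<and> \<Union>P = Q \<and>
    (\<forall>B\<in>P. \<forall>B'\<in>P. B \<noteq> B' \<longrightarrow> interior B \<inter> interior B' = {})"

text \<open>\<open>sub n B\<close> is the set of the elements of \<open>P (Suc n)\<close> into which \<open>B \<in> P n\<close> is subdivided.
  It is not determined by inclusion alone, since elements may have empty interior.\<close>

definition successively_finer ::
    "(nat \<Rightarrow> 'x::metric_space set set) \<Rightarrow> (nat \<Rightarrow> 'x set \<Rightarrow> 'x set set) \<Rightarrow> bool" where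
  "successively_finer P sub \<longleftrightarrow>
    (\<exists>\<theta>\<in>{0<..<1::real}. \<forall>n.
      (\<forall>B\<in>P n. finite (sub n B) \<and> sub n B \<subseteq> P (Suc n) \<and> B = \<Union>(sub n B) \<and>
        (\<forall>B'\<in>sub n B. diameter B' \<le> \<theta> * diameter B)) \<and>
      P (Suc n) = (\<Union>B\<in>P n. sub n B))"


section \<open>The continuation method\<close>

primrec subdivision_boxes ::
    "('x \<Rightarrow> 'x) \<Rightarrow> (nat \<Rightarrow> 'x set \<Rightarrow> 'x set set) \<Rightarrow> nat \<Rightarrow> 'x set \<Rightarrow> nat \<Rightarrow> 'x set set" where
  "subdivision_boxes \<phi> sub s C 0 = {C}"
| "subdivision_boxes \<phi> sub s C (Suc l) =
    (let Bhat = (\<Union>B\<in>subdivision_boxes \<phi> sub s C l. sub (s + l) B)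
     in {B \<in> Bhat. \<exists>B'\<in>Bhat. \<phi> -` B \<inter> B' \<noteq> {}})"

text \<open>\<open>continuation_boxes \<phi> P sub s C l j\<close> is \<open>\<C>\<^sub>j\<close> on the level \<open>l\<close>, and \<open>continuation_set\<close> is
  its union.\<close>

primrec continuation_boxes ::
    "('x \<Rightarrow> 'x) \<Rightarrow> (nat \<Rightarrow> 'x set set) \<Rightarrow> (nat \<Rightarrow> 'x set \<Rightarrow> 'x set set) \<Rightarrow> nat \<Rightarrow> 'x set
      \<Rightarrow> nat \<Rightarrow> nat \<Rightarrow> 'x set set" where
  "continuation_boxes \<phi> P sub s C l 0 = subdivision_boxes \<phi> sub s C l"
| "continuation_boxes \<phi> P sub s C l (Suc j) =
    {B \<in> P (s + l). \<exists>B'\<in>continuation_boxes \<phi> P sub s C l j. B \<inter> \<phi> ` B' \<noteq> {}}"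

definition continuation_set ::
    "('x \<Rightarrow> 'x) \<Rightarrow> (nat \<Rightarrow> 'x set set) \<Rightarrow> (nat \<Rightarrow> 'x set \<Rightarrow> 'x set set) \<Rightarrow> nat \<Rightarrow> 'x set
      \<Rightarrow> nat \<Rightarrow> nat \<Rightarrow> 'x set" where
  "continuation_set \<phi> P sub s C l j = \<Union>(continuation_boxes \<phi> P sub s C l j)"

definition continuation_stop ::
    "('x \<Rightarrow> 'x) \<Rightarrow> (nat \<Rightarrow> 'x set set) \<Rightarrow> (nat \<Rightarrow> 'x set \<Rightarrow> 'x set set) \<Rightarrow> nat \<Rightarrow> 'x set
      \<Rightarrow> nat \<Rightarrow> nat" where
  "continuation_stop \<phi> P sub s C l =
    (LEAST J. continuation_boxes \<phi> P sub s C l (Suc J)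
       \<subseteq> (\<Union>j\<le>J. continuation_boxes \<phi> P sub s C l j))"

definition continuation_cover ::
    "('x \<Rightarrow> 'x) \<Rightarrow> (nat \<Rightarrow> 'x set set) \<Rightarrow> (nat \<Rightarrow> 'x set \<Rightarrow> 'x set set) \<Rightarrow> nat \<Rightarrow> 'x set
      \<Rightarrow> nat \<Rightarrow> 'x set" where
  "continuation_cover \<phi> P sub s C l =
    (\<Union>j\<le>continuation_stop \<phi> P sub s C l. continuation_set \<phi> P sub s C l j)"

lemma continuation_cover_eq:
  assumes fin: "finite (P (s + l))"
  shows "continuation_cover \<phi> P sub s C l = (\<Union>j. continuation_set \<phi> P sub s C l j)"
proof -
  define c where "c = continuation_boxes \<phi> P sub s C l"
  define J where "J = continuation_stop \<phi> P sub s C l"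
  have step: "B \<in> c (Suc i)" if "B \<in> c (Suc j)" "c j \<subseteq> \<Union>(c ` I)" "i \<in> I" "B' \<in> c i"
      "B \<inter> \<phi> ` B' \<noteq> {}" for B B' i j I
    using that unfolding c_def by auto
  have ex: "\<exists>J. c (Suc J) \<subseteq> (\<Union>j\<le>J. c j)"
  proof (rule ccontr)
    assume "\<nexists>J. c (Suc J) \<subseteq> (\<Union>j\<le>J. c j)"
    then have "\<forall>J. \<exists>B. B \<in> c (Suc J) \<and> B \<notin> (\<Union>j\<le>J. c j)" by blast
    then obtain f where f: "\<And>J. f J \<in> c (Suc J)" "\<And>J. f J \<notin> (\<Union>j\<le>J. c j)"
      by metis
    have "f i \<noteq> f j" if "i < j" for i j
      using f(1)[of i] f(2)[of j] that by (metis Suc_leI UN_I atMost_iff)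
    then have "inj f" by (metis injI linorder_neqE_nat)
    moreover have "range f \<subseteq> P (s + l)" using f(1) unfolding c_def by auto
    ultimately show False
      using fin finite_subset finite_imageD infinite_UNIV_nat by blast
  qed
  have J: "c (Suc J) \<subseteq> (\<Union>j\<le>J. c j)"
    using LeastI_ex[OF ex] unfolding J_def continuation_stop_def c_def .
  have "c n \<subseteq> (\<Union>j\<le>J. c j)" for n
  proof (induction n)
    case 0
    show ?case by blast
  next
    case (Suc n)
    show ?case
    proof
      fix B assume B: "B \<in> c (Suc n)"
      then obtain B' where B': "B' \<in> c n" "B \<inter> \<phi> ` B' \<noteq> {}" unfolding c_def by auto
      with Suc obtain i where i: "i \<le> J" "B' \<in> c i" by blast
      then have "B \<in> c (Suc i)" using step[OF B Suc, of i] B'(2) by auto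
      then show "B \<in> (\<Union>j\<le>J. c j)"
        using J i(1) by (cases "i = J") (auto intro: bexI[of _ "Suc i"])
    qed
  qed
  then show ?thesis
    unfolding continuation_cover_def continuation_set_def J_def[symmetric] c_def[symmetric]
    by blast
qed

end

theory Submission
  imports Defs
begin

text \<open>The closure \<open>K\<close> of the local unstable manifold satisfies \<open>K \<subseteq> \<Phi> ` K\<close>, and a compact subset
  \<open>D\<close> of the basin with \<open>D \<subseteq> \<Phi> ` D\<close> lies in the attracting set \<open>K\<close>. Hence \<open>\<Phi> ` K = K\<close>, every
  \<open>W j\<close> equals \<open>S = R ` K\<close>, and \<open>S\<close> is also the closure of the embedded unstable manifold. By
  compactness, the limit \<open>B\<close> of the subdivision of \<open>C\<close> satisfies \<open>B \<subseteq> \<phi> ` B\<close>; pulling it back by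
  \<open>E\<close> gives a compact set \<open>D\<close> as above, so \<open>B = S\<close>. The limits of the continuation steps follow by
  induction. If the distance to \<open>S\<close> contracts by \<open>\<mu>\<close>, the initial boxes are \<open>e\<close>-close to \<open>S\<close>
  and all diameters are at most \<open>(1 - \<mu>) e\<close>, then all continuation steps stay \<open>e\<close>-close to \<open>S\<close>.\<close>

section \<open>Observation maps and attracting sets\<close>

lemma continuous_on_funpow:
  fixes f :: "'a::topological_space \<Rightarrow> 'a"
  assumes "continuous_on UNIV f"
  shows "continuous_on UNIV (f ^^ n)"
proof (induction n)
  case (Suc n)
  show ?case
    unfolding funpow.simps(2)
    by (rule continuous_on_compose[OF Suc continuous_on_subset[OF assms subset_UNIV]])
qed (simp add: id_def)

text \<open>A delay coordinate is a Lipschitz observable composed with an iterate of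
  \<open>\<Phi>\<close>, so continuity of \<open>\<Phi>\<close> carries over to it.\<close>

lemma continuous_on_observation_map:
  fixes \<Phi> :: "'y::real_normed_vector \<Rightarrow> 'y" and R :: "'y \<Rightarrow> real ^ 'k"
  assumes \<Phi>: "continuous_on UNIV \<Phi>" and R: "observation_map \<Phi> R"
  shows "continuous_on UNIV R"
proof -
  have coord: "continuous_on UNIV (\<lambda>u. f ((\<Phi> ^^ n) u))"
    if "\<exists>L. L-lipschitz_on UNIV f" for f :: "'y \<Rightarrow> real" and n
  proof -
    have "continuous_on UNIV f"
      using that lipschitz_on_continuous_on by blast
    then show ?thesis
      by (rule continuous_on_compose2) (auto intro: continuous_on_funpow[OF \<Phi>])
  qed
  have comp: "continuous_on UNIV R" if "\<And>i. continuous_on UNIV (\<lambda>u. R u $ i)"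
    using continuous_on_vec_lambda[of UNIV "\<lambda>i u. R u $ i"] that by simp
  consider "bounded_linear R" | "delay_map \<Phi> R" | "multi_delay_map \<Phi> R"
    using R unfolding observation_map_def by blast
  then show ?thesis
  proof cases
    case 1
    then show ?thesis
      by (simp add: linear_continuous_on)
  next
    case 2
    then obtain f :: "'y \<Rightarrow> real" and \<iota> where f: "\<exists>L. L-lipschitz_on UNIV f"
      and "\<forall>u i. R u $ i = f ((\<Phi> ^^ \<iota> i) u)"
      unfolding delay_map_def by blast
    then show ?thesis
      using coord[OF f] by (intro comp) simp
  next
    case 3
    then obtain q :: nat and f :: "nat \<Rightarrow> 'y \<Rightarrow> real" and d :: "nat \<Rightarrow> nat" and \<iota>
      where f: "\<forall>a<q. \<exists>L. L-lipschitz_on UNIV (f a)"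
      and \<iota>: "bij_betw \<iota> (UNIV :: 'k set) (SIGMA a:{..<q}. {..<d a})"
      and R: "\<forall>u i. R u $ i = f (fst (\<iota> i)) ((\<Phi> ^^ snd (\<iota> i)) u)"
      unfolding multi_delay_map_def by blast
    have "fst (\<iota> i) < q" for i
    proof -
      have "\<iota> i \<in> (SIGMA a:{..<q}. {..<d a})"
        using bij_betwE[OF \<iota>] by blast
      then show ?thesis by auto
    qed
    then show ?thesis
      using R coord f by (intro comp) simp
  qed
qed

text \<open>Each point of \<open>D\<close> has \<open>m\<close>-th preimages in \<open>D\<close> for
  every \<open>m\<close>. By compactness the entry times of points of \<open>D\<close> into
  \<open>U0\<close> are bounded, so for large \<open>m\<close> these orbits end in any given open
  neighbourhood of \<open>K\<close>. For a point outside \<open>K\<close>, its complement is such a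
  neighbourhood.\<close>

lemma backward_invariant_subset_attracting_set:
  fixes \<Phi> :: "'y::t1_space \<Rightarrow> 'y"
  assumes att: "attracting_set \<Phi> K U0" and cont: "continuous_on UNIV \<Phi>"
    and D: "compact D" "D \<subseteq> basin_of_attraction \<Phi> U0" "D \<subseteq> \<Phi> ` D"
  shows "D \<subseteq> K"
proof
  fix x assume x: "x \<in> D"
  have iter: "D \<subseteq> (\<Phi> ^^ m) ` D" for m
  proof (induction m)
    case (Suc m)
    then have "\<Phi> ` D \<subseteq> \<Phi> ` (\<Phi> ^^ m) ` D"
      by (rule image_mono)
    then have "\<Phi> ` D \<subseteq> (\<Phi> ^^ Suc m) ` D"
      by (simp only: funpow.simps(2) image_comp)
    with D(3) show ?case by blast
  qed simp
  have "open ((\<Phi> ^^ j) -` U0)" for j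
    using att continuous_on_funpow[OF cont] unfolding attracting_set_def
    by (simp add: open_vimage)
  then obtain J where J: "finite J" "D \<subseteq> (\<Union>j\<in>J. (\<Phi> ^^ j) -` U0)"
    by (rule compactE_image[OF D(1) _ D(2)[unfolded basin_of_attraction_def]])
  show "x \<in> K"
  proof (rule ccontr)
    assume "x \<notin> K"
    then have "open (- {x})" "K \<subseteq> - {x}"
      by (auto simp: open_Compl)
    then obtain n where n: "\<And>j. j \<ge> n \<Longrightarrow> (\<Phi> ^^ j) ` U0 \<subseteq> - {x}"
      using att unfolding attracting_set_def by meson
    \<comment> \<open>The maximum bounds the entry time into \<open>U0\<close>, and \<open>n\<close>
      further steps lead into the complement of \<open>x\<close>. Inserting 0 keeps the maximum
      defined when \<open>J\<close> is empty.\<close>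
    define m where "m = n + Max (insert 0 J)"
    obtain y where y: "y \<in> D" "(\<Phi> ^^ m) y = x"
      using iter[of m] x by blast
    obtain j where j: "j \<in> J" "(\<Phi> ^^ j) y \<in> U0"
      using J y(1) by auto
    have "j \<le> Max (insert 0 J)"
      using J(1) j(1) by simp
    then have "m = (m - j) + j" "m - j \<ge> n"
      unfolding m_def by auto
    then have "(\<Phi> ^^ (m - j)) ((\<Phi> ^^ j) y) = x"
      using y(2) by (metis comp_apply funpow_add)
    then show False
      using n[OF \<open>m - j \<ge> n\<close>] j(2) by blast
  qed
qed

text \<open>\<open>attracting_set\<close> does not state forward invariance. It follows because the
  image of \<open>K\<close> is again compact and backward invariant and lies in the basin.\<close>

lemma attracting_set_invariant:
  fixes \<Phi> :: "'y::t1_space \<Rightarrow> 'y"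
  assumes att: "attracting_set \<Phi> K U0" and cont: "continuous_on UNIV \<Phi>"
    and K: "K \<subseteq> \<Phi> ` K"
  shows "\<Phi> ` K = K"
proof
  have "open U0" "K \<subseteq> U0" "compact K"
    using att unfolding attracting_set_def by auto
  \<comment> \<open>The attracting property is applied to \<open>U0\<close> itself as the
    neighbourhood of \<open>K\<close>.\<close>
  then obtain n where n: "\<And>j. j \<ge> n \<Longrightarrow> (\<Phi> ^^ j) ` U0 \<subseteq> U0"
    using att unfolding attracting_set_def by meson
  have "\<Phi> u \<in> basin_of_attraction \<Phi> U0" if "u \<in> K" for u
  proof -
    have "(\<Phi> ^^ Suc n) u \<in> U0"
      using n[of "Suc n"] that \<open>K \<subseteq> U0\<close> by fastforce
    then show ?thesis
      unfolding basin_of_attraction_def by (auto simp: funpow_swap1)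
  qed
  moreover have "compact (\<Phi> ` K)"
    using \<open>compact K\<close> cont compact_continuous_image continuous_on_subset by blast
  ultimately show "\<Phi> ` K \<subseteq> K"
    using K by (intro backward_invariant_subset_attracting_set[OF att cont]) auto
qed (rule K)

section \<open>Unstable manifolds\<close>

lemma backward_orbit_to_shift:
  assumes "backward_orbit_to \<Phi> ustar u v"
  shows "backward_orbit_to \<Phi> ustar (v n) (\<lambda>j. v (j + n))"
  using assms unfolding backward_orbit_to_def by (auto intro: LIMSEQ_ignore_initial_segment)

lemma backward_orbit_to_funpow:
  assumes "backward_orbit_to \<Phi> ustar u v"
  shows "(\<Phi> ^^ n) (v n) = u"
  using assms unfolding backward_orbit_to_def by (induction n) (auto simp: funpow_swap1)

text \<open>Dropping the first point of a backward orbit leaves a backward orbit in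
  \<open>N\<close>.\<close>

lemma local_unstable_manifold_backward_invariant:
  "local_unstable_manifold \<Phi> ustar N \<subseteq> \<Phi> ` local_unstable_manifold \<Phi> ustar N"
proof
  fix u assume "u \<in> local_unstable_manifold \<Phi> ustar N"
  then obtain v where v: "backward_orbit_to \<Phi> ustar u v" "\<forall>j. v j \<in> N"
    unfolding local_unstable_manifold_def by blast
  have "v 1 \<in> local_unstable_manifold \<Phi> ustar N"
    using backward_orbit_to_shift[OF v(1)] v(2) unfolding local_unstable_manifold_def by blast
  moreover have "\<Phi> (v 1) = u"
    using backward_orbit_to_funpow[OF v(1), of 1] by simp
  ultimately show "u \<in> \<Phi> ` local_unstable_manifold \<Phi> ustar N"
    by blast
qed

text \<open>A backward orbit tending to \<open>ustar\<close> eventually stays in \<open>N\<close>,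
  and the start of that tail is carried to \<open>u\<close> by an iterate of
  \<open>\<Phi>\<close>.\<close>

lemma unstable_manifold_funpow_local:
  assumes "ustar \<in> interior N" "u \<in> unstable_manifold \<Phi> ustar"
  shows "\<exists>n. u \<in> (\<Phi> ^^ n) ` local_unstable_manifold \<Phi> ustar N"
proof -
  obtain v where v: "backward_orbit_to \<Phi> ustar u v"
    using assms(2) unfolding unstable_manifold_def by blast
  then have "v \<longlonglongrightarrow> ustar"
    unfolding backward_orbit_to_def by blast
  then have "\<forall>\<^sub>F j in sequentially. v j \<in> interior N"
    using assms(1) by (simp add: topological_tendstoD)
  then obtain n where "\<And>j. j \<ge> n \<Longrightarrow> v j \<in> N"
    unfolding eventually_sequentially using interior_subset by blast
  then have "v n \<in> local_unstable_manifold \<Phi> ustar N"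
    using backward_orbit_to_shift[OF v, of n] unfolding local_unstable_manifold_def
    by (auto intro!: exI[of _ "\<lambda>j. v (j + n)"])
  then show ?thesis
    using backward_orbit_to_funpow[OF v, of n] by blast
qed

lemma closure_unstable_manifold:
  fixes \<Phi> :: "'y::t1_space \<Rightarrow> 'y" and N :: "'y set" and ustar :: 'y
  defines "K \<equiv> closure (local_unstable_manifold \<Phi> ustar N)"
  assumes N: "ustar \<in> interior N" and inv: "\<Phi> ` K = K"
  shows "closure (unstable_manifold \<Phi> ustar) = K"
proof
  have iter: "(\<Phi> ^^ n) ` K = K" for n
  proof (induction n)
    case (Suc n)
    then show ?case
      using inv by (simp only: funpow.simps(2) image_comp[symmetric])
  qed simp
  have "unstable_manifold \<Phi> ustar \<subseteq> K"
  proof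
    fix u assume "u \<in> unstable_manifold \<Phi> ustar"
    then obtain n where "u \<in> (\<Phi> ^^ n) ` local_unstable_manifold \<Phi> ustar N"
      using unstable_manifold_funpow_local[OF N] by blast
    then have "u \<in> (\<Phi> ^^ n) ` K"
      unfolding K_def using closure_subset by blast
    then show "u \<in> K"
      using iter by simp
  qed
  then show "closure (unstable_manifold \<Phi> ustar) \<subseteq> K"
    unfolding K_def by (simp add: closure_minimal)
  show "K \<subseteq> closure (unstable_manifold \<Phi> ustar)"
    unfolding K_def
    by (intro closure_mono) (auto simp: local_unstable_manifold_def unstable_manifold_def)
qed

section \<open>Convergence of the continuation method\<close>

lemma nested_compact_convergent_subseq:
  fixes X :: "nat \<Rightarrow> 'x::metric_space set"
  assumes "\<And>l. compact (X l)" "antimono X" "\<And>l. y l \<in> X l"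
  obtains z r where "z \<in> (\<Inter>l. X l)" "strict_mono (r :: nat \<Rightarrow> nat)" "(y \<circ> r) \<longlonglongrightarrow> z"
proof -
  have mem: "y l \<in> X m" if "m \<le> l" for l m
    using antimonoD[OF assms(2) that] assms(3) by blast
  then have "\<forall>l. y l \<in> X 0"
    by simp
  then obtain z r where r: "strict_mono (r :: nat \<Rightarrow> nat)" "(y \<circ> r) \<longlonglongrightarrow> z"
    using assms(1)[of 0] unfolding compact_def by blast
  have "z \<in> X l" for l
  proof (rule closed_sequentially)
    show "closed (X l)"
      using assms(1) compact_imp_closed by blast
    show "(\<lambda>n. (y \<circ> r) (n + l)) \<longlonglongrightarrow> z"
      using r(2) by (rule LIMSEQ_ignore_initial_segment)
    show "(y \<circ> r) (n + l) \<in> X l" for n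
      using mem[of l "r (n + l)"] seq_suble[OF r(1), of "n + l"] by simp
  qed
  with r show thesis
    using that by blast
qed

text \<open>A fixed point \<open>x\<close> with approximate preimages on every level has an exact
  one in the intersection: an accumulation point of them, by continuity of
  \<open>\<phi>\<close>.\<close>

lemma limit_of_approximate_preimages:
  fixes \<phi> :: "'x::metric_space \<Rightarrow> 'z::metric_space"
  assumes "\<And>l. compact (X l)" "antimono X" "continuous_on UNIV \<phi>"
    and near: "\<And>l. \<exists>y\<in>X l. dist x (\<phi> y) \<le> \<epsilon> l" and "\<epsilon> \<longlonglongrightarrow> 0"
  shows "x \<in> \<phi> ` (\<Inter>l. X l)"
proof -
  from near have "\<forall>l. \<exists>y. y \<in> X l \<and> dist x (\<phi> y) \<le> \<epsilon> l"
    by blast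
  then obtain y where y: "\<And>l. y l \<in> X l" "\<And>l. dist x (\<phi> (y l)) \<le> \<epsilon> l"
    by metis
  obtain z r where z: "z \<in> (\<Inter>l. X l)" and r: "strict_mono (r :: nat \<Rightarrow> nat)" "(y \<circ> r) \<longlonglongrightarrow> z"
    by (rule nested_compact_convergent_subseq[of X y, OF assms(1,2) y(1)])
  have "(\<lambda>l. dist (\<phi> (y l)) x) \<longlonglongrightarrow> 0"
    by (rule tendsto_sandwich[OF _ _ tendsto_const \<open>\<epsilon> \<longlonglongrightarrow> 0\<close>])
      (use y(2) in \<open>simp_all add: dist_commute\<close>)
  then have "(\<lambda>l. \<phi> (y l)) \<longlonglongrightarrow> x"
    by (rule tendsto_dist_iff[THEN iffD2])
  then have "((\<lambda>l. \<phi> (y l)) \<circ> r) \<longlonglongrightarrow> x"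
    using r(1) by (rule LIMSEQ_subseq_LIMSEQ)
  moreover have "((\<lambda>l. \<phi> (y l)) \<circ> r) \<longlonglongrightarrow> \<phi> z"
    using continuous_on_tendsto_compose[OF assms(3) r(2)] unfolding comp_def by simp
  ultimately have "x = \<phi> z"
    by (rule LIMSEQ_unique)
  then show ?thesis
    using z by blast
qed

text \<open>Isolates the box algorithm for a continuous map on a metric space from the Banach space
  dynamics and the embedding.\<close>

locale continuation_method =
  fixes \<phi> :: "'x::metric_space \<Rightarrow> 'x" and Q :: "'x set" and P :: "nat \<Rightarrow> 'x set set"
    and sub :: "nat \<Rightarrow> 'x set \<Rightarrow> 'x set set" and s :: nat and C :: "'x set"
  assumes cont: "continuous_on UNIV \<phi>"
    and partition: "\<And>n. box_partition Q (P n)"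
    and finer: "successively_finer P sub"
    and C: "C \<in> P s"
begin

abbreviation boxes where "boxes \<equiv> continuation_boxes \<phi> P sub s C"
abbreviation covering where "covering \<equiv> continuation_set \<phi> P sub s C"

text \<open>The boxes from which level \<open>Suc l\<close> is selected, indexed by the level
  \<open>l\<close> of their parents.\<close>

definition candidates :: "nat \<Rightarrow> 'x set set" where
  "candidates l = (\<Union>B\<in>subdivision_boxes \<phi> sub s C l. sub (s + l) B)"

lemma subdivision_boxes_Suc:
  "subdivision_boxes \<phi> sub s C (Suc l) =
    {B \<in> candidates l. \<exists>B'\<in>candidates l. \<phi> -` B \<inter> B' \<noteq> {}}"
  by (simp add: candidates_def Let_def)

lemma refinement:
  obtains \<theta> where "0 < \<theta>" "\<theta> < 1"
    "\<And>n B. B \<in> P n \<Longrightarrow> \<Union>(sub n B) = B"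
    "\<And>n B B'. B \<in> P n \<Longrightarrow> B' \<in> sub n B \<Longrightarrow> diameter B' \<le> \<theta> * diameter B"
    "\<And>n. P (Suc n) = (\<Union>B\<in>P n. sub n B)"
proof -
  obtain \<theta> where \<theta>: "\<theta> \<in> {0<..<1}" and
    ref: "\<forall>n. (\<forall>B\<in>P n. finite (sub n B) \<and> sub n B \<subseteq> P (Suc n) \<and> B = \<Union>(sub n B) \<and>
      (\<forall>B'\<in>sub n B. diameter B' \<le> \<theta> * diameter B)) \<and> P (Suc n) = (\<Union>B\<in>P n. sub n B)"
    using finer unfolding successively_finer_def by (rule bexE)
  show thesis
  proof (rule that[of \<theta>])
    show "0 < \<theta>" "\<theta> < 1"
      using \<theta> by auto
    show "P (Suc n) = (\<Union>B\<in>P n. sub n B)" for n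
      by (rule conjunct2[OF spec[OF ref, of n]])
    fix n B assume "B \<in> P n"
    note B = bspec[OF conjunct1[OF spec[OF ref, of n]] this]
    show "\<Union>(sub n B) = B"
      using B by (elim conjE) (rule sym)
    show "diameter B' \<le> \<theta> * diameter B" if "B' \<in> sub n B" for B'
      using B that by (elim conjE) (rule bspec)
  qed
qed

lemma P_Suc: "P (Suc n) = (\<Union>B\<in>P n. sub n B)"
  by (rule refinement)

lemma sub_subset: "B \<in> P n \<Longrightarrow> sub n B \<subseteq> P (Suc n)"
  unfolding P_Suc by blast

lemma Union_sub: "B \<in> P n \<Longrightarrow> \<Union>(sub n B) = B"
  by (rule refinement)

lemma subdivision_boxes_subset: "subdivision_boxes \<phi> sub s C l \<subseteq> P (s + l)"
proof (induction l)
  case (Suc l)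
  have "candidates l \<subseteq> P (Suc (s + l))"
    unfolding candidates_def using Suc sub_subset by blast
  then show ?case
    unfolding subdivision_boxes_Suc by auto
qed (simp add: C)

lemma boxes_subset: "boxes l j \<subseteq> P (s + l)"
  using subdivision_boxes_subset by (cases j) auto

text \<open>Subdividing alone keeps the union; a covering shrinks only through selection.\<close>

lemma Union_candidates: "\<Union>(candidates l) = covering l 0"
proof -
  have "\<Union>(candidates l) = (\<Union>B\<in>subdivision_boxes \<phi> sub s C l. \<Union>(sub (s + l) B))"
    unfolding candidates_def by blast
  also have "\<dots> = (\<Union>B\<in>subdivision_boxes \<phi> sub s C l. B)"
    using subdivision_boxes_subset[of l] by (intro SUP_cong refl Union_sub) blast
  finally show ?thesis
    unfolding continuation_set_def by simp
qed

text \<open>In the continuation step, parents of boxes that meet under \<open>\<phi>\<close> also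
  meet, since they are larger. This makes the coverings decrease with the level.\<close>

lemma boxes_have_parents: "B \<in> boxes (Suc l) j \<Longrightarrow> \<exists>B'\<in>boxes l j. B \<subseteq> B'"
proof (induction j arbitrary: B)
  case 0
  then obtain B' where B': "B' \<in> subdivision_boxes \<phi> sub s C l" "B \<in> sub (s + l) B'"
    unfolding continuation_boxes.simps subdivision_boxes_Suc candidates_def by blast
  then have "\<Union>(sub (s + l) B') = B'"
    using Union_sub subdivision_boxes_subset by blast
  then show ?case
    using B' by auto
next
  case (Suc j)
  then obtain D where D: "D \<in> boxes (Suc l) j" "B \<inter> \<phi> ` D \<noteq> {}"
    by auto
  obtain D' where D': "D' \<in> boxes l j" "D \<subseteq> D'"
    using Suc.IH D(1) by blast
  have "B \<in> P (Suc (s + l))"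
    using Suc.prems by simp
  then obtain B' where B': "B' \<in> P (s + l)" "B \<in> sub (s + l) B'"
    unfolding P_Suc by blast
  then have "B \<subseteq> B'"
    using Union_sub by blast
  have "B' \<inter> \<phi> ` D' \<noteq> {}"
    using D(2) D'(2) \<open>B \<subseteq> B'\<close> by blast
  then have "B' \<in> boxes l (Suc j)"
    using B'(1) D'(1) by auto
  then show ?case
    using \<open>B \<subseteq> B'\<close> by blast
qed

lemma antimono_covering: "antimono (\<lambda>l. covering l j)"
  unfolding antimono_iff_le_Suc continuation_set_def
  by (intro allI Union_subsetI) (use boxes_have_parents in blast)

lemma compact_covering: "compact (covering l j)"
  unfolding continuation_set_def
proof (rule compact_Union)
  show "finite (boxes l j)"
    using boxes_subset partition finite_subset unfolding box_partition_def by metis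
  show "compact B" if "B \<in> boxes l j" for B
    using that boxes_subset partition unfolding box_partition_def by blast
qed

lemma covering_subset: "covering l j \<subseteq> Q"
  using boxes_subset partition unfolding continuation_set_def box_partition_def by blast

text \<open>The common ratio \<open>\<theta>\<close> makes the diameters decay geometrically from
  the largest one in the finite family \<open>P s\<close>, so one null sequence serves all boxes of
  each level.\<close>

lemma box_diameters:
  obtains \<epsilon> where "\<epsilon> \<longlonglongrightarrow> 0"
    "\<And>l B x y. B \<in> P (s + l) \<Longrightarrow> x \<in> B \<Longrightarrow> y \<in> B \<Longrightarrow> dist x y \<le> \<epsilon> l"
proof -
  obtain \<theta> where \<theta>: "0 < \<theta>" "\<theta> < 1"
    and diam: "\<And>n B B'. B \<in> P n \<Longrightarrow> B' \<in> sub n B \<Longrightarrow> diameter B' \<le> \<theta> * diameter B"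
    by (rule refinement) (rule that)
  define D where "D = Max (diameter ` P s)"
  have "diameter B \<le> D * \<theta> ^ l" if "B \<in> P (s + l)" for l B
    using that
  proof (induction l arbitrary: B)
    case 0
    then show ?case
      using partition[of s] unfolding D_def box_partition_def by simp
  next
    case (Suc l)
    then obtain B' where B': "B' \<in> P (s + l)" "B \<in> sub (s + l) B'"
      using P_Suc[of "s + l"] by auto
    have "diameter B \<le> \<theta> * diameter B'"
      using diam B' by blast
    also have "\<dots> \<le> \<theta> * (D * \<theta> ^ l)"
      using Suc.IH[OF B'(1)] \<theta> by simp
    finally show ?case
      by (simp add: mult_ac)
  qed
  moreover have "dist x y \<le> diameter B" if "B \<in> P (s + l)" "x \<in> B" "y \<in> B" for l B x y
    using that partition diameter_bounded_bound compact_imp_bounded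
    unfolding box_partition_def by metis
  moreover have "(\<lambda>l. D * \<theta> ^ l) \<longlonglongrightarrow> 0"
    using \<theta> by (intro tendsto_mult_right_zero LIMSEQ_realpow_zero) auto
  ultimately show thesis
    using that[of "\<lambda>l. D * \<theta> ^ l"] by (meson order_trans)
qed

section \<open>Limits of the coverings as the level grows\<close>

lemma covering_Suc_cases:
  assumes "x \<in> covering l (Suc j)"
  obtains B y where "B \<in> P (s + l)" "x \<in> B" "\<phi> y \<in> B" "y \<in> covering l j"
  using assms unfolding continuation_set_def by auto

text \<open>The selection rule puts \<open>x\<close> in one box with an image
  \<open>\<phi> y\<close>, which gives approximate preimages on every level.\<close>

lemma Inter_subdivision_backward_invariant:
  "(\<Inter>l. covering l 0) \<subseteq> \<phi> ` (\<Inter>l. covering l 0)"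
proof
  fix x assume x: "x \<in> (\<Inter>l. covering l 0)"
  obtain \<epsilon> where \<epsilon>: "\<epsilon> \<longlonglongrightarrow> 0"
    "\<And>l B x y. B \<in> P (s + l) \<Longrightarrow> x \<in> B \<Longrightarrow> y \<in> B \<Longrightarrow> dist x y \<le> \<epsilon> l"
    by (rule box_diameters) (rule that)
  \<comment> \<open>The levels differ by one: the box around \<open>x\<close> has level
    \<open>Suc l\<close>, but \<open>y\<close> lies in a candidate that need not survive the
    selection, so \<open>y\<close> is located only in the covering of level
    \<open>l\<close>.\<close>
  have "\<exists>y\<in>covering l 0. dist x (\<phi> y) \<le> \<epsilon> (Suc l)" for l
  proof -
    obtain B where B: "B \<in> subdivision_boxes \<phi> sub s C (Suc l)" "x \<in> B"
      using x unfolding continuation_set_def continuation_boxes.simps by blast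
    then obtain B' y where "B' \<in> candidates l" "y \<in> B'" "\<phi> y \<in> B"
      unfolding subdivision_boxes_Suc by blast
    moreover have "B \<in> P (s + Suc l)"
      using B(1) subdivision_boxes_subset by blast
    ultimately show ?thesis
      using \<epsilon>(2)[of B "Suc l" x "\<phi> y"] B(2) Union_candidates by blast
  qed
  moreover have "(\<lambda>l. \<epsilon> (Suc l)) \<longlonglongrightarrow> 0"
    using \<epsilon>(1) by (rule LIMSEQ_Suc)
  ultimately show "x \<in> \<phi> ` (\<Inter>l. covering l 0)"
    by (rule limit_of_approximate_preimages[OF compact_covering antimono_covering cont])
qed

lemma Inter_covering_Suc: "(\<Inter>l. covering l (Suc j)) \<subseteq> \<phi> ` (\<Inter>l. covering l j)"
proof
  fix x assume x: "x \<in> (\<Inter>l. covering l (Suc j))"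
  obtain \<epsilon> where \<epsilon>: "\<epsilon> \<longlonglongrightarrow> 0"
    "\<And>l B x y. B \<in> P (s + l) \<Longrightarrow> x \<in> B \<Longrightarrow> y \<in> B \<Longrightarrow> dist x y \<le> \<epsilon> l"
    by (rule box_diameters) (rule that)
  have "\<exists>y\<in>covering l j. dist x (\<phi> y) \<le> \<epsilon> l" for l
  proof -
    have "x \<in> covering l (Suc j)"
      using x by blast
    then obtain B y where "B \<in> P (s + l)" "x \<in> B" "\<phi> y \<in> B" "y \<in> covering l j"
      by (rule covering_Suc_cases)
    then show ?thesis
      using \<epsilon>(2) by blast
  qed
  then show "x \<in> \<phi> ` (\<Inter>l. covering l j)"
    using \<epsilon>(1)
    by (rule limit_of_approximate_preimages[OF compact_covering antimono_covering cont])
qed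

text \<open>Every point of \<open>S\<close> has a preimage in \<open>S\<close>, and this preimage
  certifies the boxes around the point in the selection and in each continuation step.\<close>

lemma invariant_subset_covering:
  assumes S: "S \<subseteq> C" "\<phi> ` S = S"
  shows "S \<subseteq> covering l j"
proof (induction j)
  case 0
  show ?case
  proof (induction l)
    case 0
    then show ?case
      using S(1) by (simp add: continuation_set_def)
  next
    case (Suc l)
    show ?case
    proof
      fix x assume "x \<in> S"
      then have "x \<in> \<phi> ` S"
        by (simp only: S(2))
      then obtain y where y: "y \<in> S" "\<phi> y = x"
        by blast
      have "x \<in> \<Union>(candidates l)" "y \<in> \<Union>(candidates l)"
        unfolding Union_candidates using Suc \<open>x \<in> S\<close> y(1) by blast+
      then obtain B B' where B: "B \<in> candidates l" "x \<in> B" "B' \<in> candidates l" "y \<in> B'"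
        by blast
      then have "y \<in> \<phi> -` B \<inter> B'"
        using y(2) by simp
      then have "B \<in> subdivision_boxes \<phi> sub s C (Suc l)"
        unfolding subdivision_boxes_Suc using B(1,3) by blast
      then show "x \<in> covering (Suc l) 0"
        using \<open>x \<in> B\<close> unfolding continuation_set_def continuation_boxes.simps by blast
    qed
  qed
next
  case (Suc j)
  show ?case
  proof
    fix x assume x: "x \<in> S"
    then have "x \<in> \<phi> ` S"
      by (simp only: S(2))
    then obtain y where y: "y \<in> S" "\<phi> y = x"
      by blast
    obtain B' where B': "B' \<in> boxes l j" "y \<in> B'"
      using subsetD[OF Suc y(1)] unfolding continuation_set_def by blast
    \<comment> \<open>The partition of level \<open>s + l\<close> covers \<open>Q\<close>, so it has
      a box around \<open>x\<close>.\<close>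
    have "C \<subseteq> Q"
      using C partition[of s] unfolding box_partition_def by simp
    then have "x \<in> \<Union>(P (s + l))"
      using x S(1) partition[of "s + l"] unfolding box_partition_def by auto
    then obtain B where B: "B \<in> P (s + l)" "x \<in> B"
      by blast
    moreover have "x \<in> \<phi> ` B'"
      using B'(2) y(2) by (rule rev_image_eqI[OF _ sym])
    ultimately have "B \<inter> \<phi> ` B' \<noteq> {}"
      by blast
    then have "B \<in> boxes l (Suc j)"
      using B(1) B'(1) by auto
    then show "x \<in> covering l (Suc j)"
      using B(2) unfolding continuation_set_def by blast
  qed
qed

lemma Inter_covering:
  assumes S: "S \<subseteq> C" "\<phi> ` S = S" and base: "(\<Inter>l. covering l 0) \<subseteq> S"
  shows "(\<Inter>l. covering l j) = S"
proof
  show "(\<Inter>l. covering l j) \<subseteq> S"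
  proof (induction j)
    case (Suc j)
    have "(\<Inter>l. covering l (Suc j)) \<subseteq> \<phi> ` S"
      using Inter_covering_Suc image_mono[OF Suc] by (rule order_trans)
    then show ?case
      by (simp only: S(2))
  qed (rule base)
  show "S \<subseteq> (\<Inter>l. covering l j)"
    using invariant_subset_covering[OF S] by blast
qed

text \<open>Otherwise points at distance at least \<open>e\<close> from \<open>S\<close> exist on
  every level and accumulate at a point of the intersection, which lies in \<open>S\<close>.\<close>

lemma covering_close:
  assumes base: "(\<Inter>l. covering l 0) \<subseteq> S" and "0 < e"
  shows "\<forall>\<^sub>F l in sequentially. \<forall>x\<in>covering l 0. infdist x S < e"
proof -
  have "\<exists>l. \<forall>x\<in>covering l 0. infdist x S < e"
  proof (rule ccontr)
    assume "\<nexists>l. \<forall>x\<in>covering l 0. infdist x S < e"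
    then have "\<forall>l. \<exists>x. x \<in> covering l 0 \<and> e \<le> infdist x S"
      by (meson not_less)
    then obtain y where y: "\<And>l. y l \<in> covering l 0" "\<And>l. e \<le> infdist (y l) S"
      by metis
    obtain z r where z: "z \<in> (\<Inter>l. covering l 0)" and "(y \<circ> r) \<longlonglongrightarrow> z"
      by (rule nested_compact_convergent_subseq[OF compact_covering antimono_covering y(1)])
    then have "(\<lambda>l. infdist ((y \<circ> r) l) S) \<longlonglongrightarrow> infdist z S"
      by (intro tendsto_infdist)
    then have "e \<le> infdist z S"
      using y(2) by (intro LIMSEQ_le_const) auto
    moreover have "infdist z S = 0"
      using z base by auto
    ultimately show False
      using \<open>0 < e\<close> by simp
  qed
  then obtain l where l: "\<forall>x\<in>covering l 0. infdist x S < e" ..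
  show ?thesis
    unfolding eventually_sequentially
    using l antimonoD[OF antimono_covering[of 0], of l] by blast
qed

text \<open>The limits for fixed \<open>j\<close> do not control the union over all
  \<open>j\<close>. The contraction gives, on one level, a bound that is uniform in
  \<open>j\<close>.\<close>

lemma Inter_continuation_cover:
  assumes S: "S \<subseteq> C" "\<phi> ` S = S" "closed S" "S \<noteq> {}" and base: "(\<Inter>l. covering l 0) \<subseteq> S"
    and att: "linearly_attractive \<phi> Q S"
  shows "(\<Inter>l. continuation_cover \<phi> P sub s C l) = S"
proof -
  have cover: "continuation_cover \<phi> P sub s C l = (\<Union>j. covering l j)" for l
    using partition[of "s + l"] unfolding box_partition_def
    by (intro continuation_cover_eq) (rule conjunct1)
  obtain \<mu> U where "\<mu> \<in> {0<..<1}" "Q \<subseteq> U"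
    and contract: "\<forall>y\<in>U. infdist (\<phi> y) S \<le> \<mu> * infdist y S"
    using att unfolding linearly_attractive_def by (elim bexE exE conjE) (rule that)
  then have \<mu>: "0 < \<mu>" "\<mu> < 1" and Q: "\<And>y. y \<in> Q \<Longrightarrow> infdist (\<phi> y) S \<le> \<mu> * infdist y S"
    using bspec[OF contract] by auto
  obtain \<epsilon> where \<epsilon>: "\<epsilon> \<longlonglongrightarrow> 0"
    "\<And>l B x y. B \<in> P (s + l) \<Longrightarrow> x \<in> B \<Longrightarrow> y \<in> B \<Longrightarrow> dist x y \<le> \<epsilon> l"
    by (rule box_diameters) (rule that)
  have "x \<in> S" if x: "\<And>l. x \<in> (\<Union>j. covering l j)" for x
  proof -
    have "infdist x S \<le> 0"
    proof (rule field_le_epsilon)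
      fix e :: real assume "0 < e"
      \<comment> \<open>This error size makes the bound \<open>e\<close> reproduce itself:
        \<open>\<mu> * e + (1 - \<mu>) * e = e\<close>.\<close>
      then have "\<forall>\<^sub>F l in sequentially. \<epsilon> l < (1 - \<mu>) * e"
        using \<epsilon>(1) \<mu>(2) by (intro order_tendstoD(2)) auto
      then have "\<forall>\<^sub>F l in sequentially. \<epsilon> l < (1 - \<mu>) * e \<and> (\<forall>x\<in>covering l 0. infdist x S < e)"
        using covering_close[OF base \<open>0 < e\<close>] by (rule eventually_conj)
      then obtain l where l: "\<epsilon> l < (1 - \<mu>) * e" "\<forall>x\<in>covering l 0. infdist x S < e"
        using eventually_happens'[OF sequentially_bot] by blast
      have "\<forall>x\<in>covering l j. infdist x S \<le> e" for j
      proof (induction j)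
        case 0
        then show ?case
          using l(2) by (auto intro: less_imp_le)
      next
        case (Suc j)
        show ?case
        proof
          fix x assume "x \<in> covering l (Suc j)"
          then obtain B y where y: "B \<in> P (s + l)" "x \<in> B" "\<phi> y \<in> B" "y \<in> covering l j"
            by (rule covering_Suc_cases)
          have "infdist x S \<le> infdist (\<phi> y) S + dist x (\<phi> y)"
            by (rule infdist_triangle)
          \<comment> \<open>The contraction applies at \<open>y\<close>, which lies in a box and
            hence in \<open>Q\<close>; its image may leave \<open>Q\<close>.\<close>
          also have "\<dots> \<le> \<mu> * infdist y S + (1 - \<mu>) * e"
            using Q[OF subsetD[OF covering_subset y(4)]] \<epsilon>(2)[OF y(1-3)] l(1) by linarith
          also have "\<dots> \<le> \<mu> * e + (1 - \<mu>) * e"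
            using Suc y(4) \<mu>(1) by simp
          finally show "infdist x S \<le> e"
            by (simp add: algebra_simps)
        qed
      qed
      then show "infdist x S \<le> 0 + e"
        using x[of l] by auto
    qed
    then have "infdist x S = 0"
      using infdist_nonneg[of x S] by simp
    then show ?thesis
      \<comment> \<open>Nonemptiness matters here because \<open>infdist\<close> to the empty set is
        0 by convention.\<close>
      using in_closed_iff_infdist_zero[OF S(3,4)] by blast
  qed
  then have "(\<Inter>l. \<Union>j. covering l j) \<subseteq> S"
    by blast
  moreover have "S \<subseteq> (\<Inter>l. \<Union>j. covering l j)"
    using invariant_subset_covering[OF S(1,2)] by (intro INF_greatest SUP_upper2[of 0]) auto
  ultimately show ?thesis
    unfolding cover by (rule equalityI)
qed

end

section \<open>The embedded unstable manifold and its box coverings\<close>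

theorem proposition5:
  fixes \<Phi> :: "'y::banach \<Rightarrow> 'y"
    and A N U0 \<U> :: "'y set"
    and R :: "'y \<Rightarrow> real ^ 'k"
    and E :: "real ^ 'k \<Rightarrow> 'y"
    and \<phi> :: "real ^ 'k \<Rightarrow> real ^ 'k"
    and ustar :: 'y
    and p :: "real ^ 'k"
    and Wu Wloc Q C :: "(real ^ 'k) set"
    and P :: "nat \<Rightarrow> (real ^ 'k) set set"
    and sub :: "nat \<Rightarrow> (real ^ 'k) set \<Rightarrow> (real ^ 'k) set set"
    and s :: nat
    and W :: "nat \<Rightarrow> (real ^ 'k) set"
  assumes Phi_lipschitz: "\<exists>L. L-lipschitz_on UNIV \<Phi>"
    and A_compact: "compact A"
    and A_invariant: "\<Phi> ` A = A"
    and R_observation: "observation_map \<Phi> R"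
    and R_inj: "inj_on R A"
    and E_extension: "core_extension R A E"
    and phi_def: "\<phi> = core_map R \<Phi> E"
    and steady: "ustar \<in> A" "\<Phi> ustar = ustar"
    and unstable_in_A: "unstable_manifold \<Phi> ustar \<subseteq> A"
    and N_nbhd: "ustar \<in> interior N"
    and p_def: "p = R ustar"
    and Wu_def: "Wu = R ` unstable_manifold \<Phi> ustar"
    and Wloc_def: "Wloc = R ` closure (local_unstable_manifold \<Phi> ustar N)"
    and Q_rectangle: "generalized_rectangle Q"
    and Wu_in_Q: "closure Wu \<subseteq> Q"
    and partitions: "\<forall>n. box_partition Q (P n)"
    and finer: "successively_finer P sub"
    and C_element: "C \<in> P s" "p \<in> interior C"
    and attracting: "attracting_set \<Phi> (closure (local_unstable_manifold \<Phi> ustar N)) U0"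
    and basin: "\<U> = basin_of_attraction \<Phi> U0"
      "closure (local_unstable_manifold \<Phi> ustar N) \<subseteq> \<U>"
    and C_location: "Wloc \<subseteq> C" "C \<subseteq> R ` A" "E ` C \<subseteq> \<U>"
    and W_def: "W 0 = Wloc" "\<forall>j. W (Suc j) = \<phi> ` W j"
  shows "((\<forall>j l. W j \<subseteq> continuation_set \<phi> P sub s C l j) \<and>
          (\<forall>j. (\<Inter>l. continuation_set \<phi> P sub s C l j) = W j)) \<and>
         (linearly_attractive \<phi> Q (closure Wu) \<longrightarrow>
          (\<Inter>l. continuation_cover \<phi> P sub s C l) = closure Wu)"
proof -
  define K where "K = closure (local_unstable_manifold \<Phi> ustar N)"
  have cont_\<Phi>: "continuous_on UNIV \<Phi>"
    using Phi_lipschitz lipschitz_on_continuous_on by blast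
  have cont_R: "continuous_on UNIV R"
    using continuous_on_observation_map[OF cont_\<Phi> R_observation] .
  have cont_E: "continuous_on UNIV E"
    using E_extension unfolding core_extension_def by blast
  have "continuous_on UNIV \<phi>"
    unfolding phi_def core_map_def using cont_\<Phi> cont_R cont_E
    by (intro continuous_on_compose) (auto elim: continuous_on_subset)
  then interpret continuation_method \<phi> Q P sub s C
    using partitions finer C_element(1) by unfold_locales auto
  have att: "attracting_set \<Phi> K U0"
    using attracting unfolding K_def .
  then have "compact K"
    unfolding attracting_set_def by blast
  have local: "local_unstable_manifold \<Phi> ustar N \<subseteq> unstable_manifold \<Phi> ustar"
    unfolding local_unstable_manifold_def unstable_manifold_def by blast
  have "K \<subseteq> A"
    unfolding K_def using local unstable_in_A A_compact
    by (intro closure_minimal) (auto intro: compact_imp_closed)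
  \<comment> \<open>A compact image is closed, so the inclusion of the local unstable manifold in it
    extends to the closure \<open>K\<close>.\<close>
  have "compact (\<Phi> ` K)"
    using \<open>compact K\<close> cont_\<Phi> compact_continuous_image continuous_on_subset by blast
  moreover have "local_unstable_manifold \<Phi> ustar N \<subseteq> \<Phi> ` K"
    unfolding K_def
    using local_unstable_manifold_backward_invariant closure_subset by blast
  ultimately have "K \<subseteq> \<Phi> ` K"
    using K_def closure_minimal compact_imp_closed by blast
  then have inv: "\<Phi> ` K = K"
    using attracting_set_invariant[OF att cont_\<Phi>] by blast
  have phi_R: "\<phi> (R u) = R (\<Phi> u)" if "u \<in> A" for u
    using that E_extension unfolding phi_def core_map_def core_extension_def by simp
  have Wloc_K: "Wloc = R ` K"
    unfolding Wloc_def K_def ..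
  have "compact Wloc"
    unfolding Wloc_K using \<open>compact K\<close> cont_R compact_continuous_image continuous_on_subset by blast
  have Wloc_inv: "\<phi> ` Wloc = Wloc"
  proof -
    have "\<phi> ` Wloc = R ` \<Phi> ` K"
      unfolding Wloc_K image_image using phi_R \<open>K \<subseteq> A\<close> by (intro image_cong) auto
    then show ?thesis
      unfolding inv Wloc_K .
  qed
  have W: "W j = Wloc" for j
    using W_def Wloc_inv by (induction j) auto
  have closure_unstable: "closure (unstable_manifold \<Phi> ustar) = K"
    using closure_unstable_manifold[OF N_nbhd] inv unfolding K_def by blast
  have closure_Wu: "closure Wu = Wloc"
  proof
    have "Wu \<subseteq> Wloc"
      unfolding Wu_def Wloc_K using closure_unstable closure_subset by blast
    then show "closure Wu \<subseteq> Wloc"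
      using \<open>compact Wloc\<close> by (simp add: closure_minimal compact_imp_closed)
    show "Wloc \<subseteq> closure Wu"
      unfolding Wu_def Wloc_K closure_unstable[symmetric]
      by (rule image_closure_subset[OF continuous_on_subset[OF cont_R subset_UNIV] closed_closure
            closure_subset])
  qed
  \<comment> \<open>The constant sequence is a backward orbit of the steady state.\<close>
  have "ustar \<in> local_unstable_manifold \<Phi> ustar N"
    using steady(2) N_nbhd interior_subset
    unfolding local_unstable_manifold_def backward_orbit_to_def
    by (auto intro!: exI[of _ "\<lambda>_. ustar"])
  then have "Wloc \<noteq> {}"
    unfolding Wloc_def using closure_subset by blast
  define B where "B = (\<Inter>l. covering l 0)"
  have base: "B \<subseteq> Wloc"
  proof -
    have "B \<subseteq> covering 0 0"
      unfolding B_def by blast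
    then have "B \<subseteq> C"
      by (simp add: continuation_set_def)
    \<comment> \<open>\<open>C\<close> lies in the image of \<open>A\<close>, where \<open>E\<close>
      inverts \<open>R\<close>; thus \<open>B\<close> can be pulled back to \<open>A\<close> without
      loss.\<close>
    have R_E: "R (E x) = x" "E x \<in> A" if "x \<in> B" for x
    proof -
      have "x \<in> R ` A"
        using that \<open>B \<subseteq> C\<close> C_location(2) by blast
      then show "R (E x) = x" "E x \<in> A"
        using E_extension unfolding core_extension_def by auto
    qed
    have "compact B"
      unfolding B_def using compact_covering compact_imp_closed by (intro compact_Inter) auto
    then have "compact (E ` B)"
      using cont_E compact_continuous_image continuous_on_subset by blast
    \<comment> \<open>Backward invariance under \<open>\<phi>\<close> is lifted to
      \<open>\<Phi>\<close>: \<open>\<Phi> (E y)\<close> and \<open>u\<close> have the same image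
      under \<open>R\<close> and both lie in \<open>A\<close>, where \<open>R\<close> is
      injective.\<close>
    moreover have "E ` B \<subseteq> \<Phi> ` E ` B"
    proof
      fix u assume "u \<in> E ` B"
      then obtain x where x: "x \<in> B" "u = E x" by blast
      then obtain y where y: "y \<in> B" "x = \<phi> y"
        using Inter_subdivision_backward_invariant unfolding B_def by blast
      have "R (\<Phi> (E y)) = R u"
        using phi_R[of "E y"] R_E x y by simp
      moreover have "\<Phi> (E y) \<in> A"
        using A_invariant R_E(2)[OF y(1)] by blast
      ultimately have "\<Phi> (E y) = u"
        using R_inj R_E(2)[OF x(1)] x(2) by (simp add: inj_on_eq_iff)
      then show "u \<in> \<Phi> ` E ` B"
        using y(1) by blast
    qed
    moreover have "E ` B \<subseteq> basin_of_attraction \<Phi> U0"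
      using \<open>B \<subseteq> C\<close> C_location(3) basin(1) by blast
    ultimately have "E ` B \<subseteq> K"
      by (intro backward_invariant_subset_attracting_set[OF att cont_\<Phi>])
    then show ?thesis
      unfolding Wloc_K using R_E(1) by (metis image_subset_iff image_eqI subsetI)
  qed
  have "W j \<subseteq> covering l j" for j l
    unfolding W using invariant_subset_covering[OF C_location(1) Wloc_inv] .
  moreover have "(\<Inter>l. covering l j) = W j" for j
    unfolding W by (rule Inter_covering[OF C_location(1) Wloc_inv base[unfolded B_def]])
  moreover have "(\<Inter>l. continuation_cover \<phi> P sub s C l) = closure Wu"
    if "linearly_attractive \<phi> Q (closure Wu)"
    using that unfolding closure_Wu
    by (rule Inter_continuation_cover[OF C_location(1) Wloc_inv
          compact_imp_closed[OF \<open>compact Wloc\<close>] \<open>Wloc \<noteq> {}\<close> base[unfolded B_def]])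
  ultimately show ?thesis
    by (intro conjI allI impI)
qed

end
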